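(* Consider the stationary decision model described in the context. Assume the following. (1) The sets $D(x)$, $x\in E$, are compact and $x\mapsto D(x)$ is upper semicontinuous, i.e. if $x_k\to x$ in $E$ and $a_k\in D(x_k)$ for $k\in\mathbb N$, then $(a_k)$ has an accumulation point in $D(x)$; $(x,a)\mapsto T(x,a,z)$ is continuous on $D$ for every $z\in\mathcal Z$; $c:D\times E\to\mathbb R$ is lower semicontinuous. (2) There exist $\alpha,\underline\epsilon,\bar\epsilon\ge0$ with $\underline\epsilon+\bar\epsilon=1$ and measurable functions $\underline b:E\to(-\infty,-\underline\epsilon]$, $\bar b:E\to[\bar\epsilon,\infty)$ such that for all $(x,a)\in D$ $$\rho\big(c(x,a,T(x,a,Z))\big)\ge\underline b(x),\qquad \rho\big(-\underline b(T(x,a,Z))\big)\le-\alpha\underline b(x),$$ $$\rho\big(c(x,a,T(x,a,Z))\big)\le\bar b(x),\qquad \rho\big(\bar b(T(x,a,Z))\big)\le\alpha\bar b(x).$$ (3) Put $b=\bar b-\underline b:E\to[1,\infty)$. For all $(\bar x,\bar a)\in D$ there exist $\epsilon>0$ and measurable $\Theta_1^{\bar x,\bar a},\Theta_2^{\bar x,\bar a}:\mathcal Z\to\mathbb R_+$ with $\Theta_1^{\bar x,\bar a}(Z),\Theta_2^{\bar x,\bar a}(Z)\in L^p$ and $|c(x,a,T(x,a,z))|\le\Theta_1^{\bar x,\bar a}(z)$, $b(T(x,a,z))\le\Theta_2^{\bar x,\bar a}(z)$ for all $z\in\mathcal Z$ and all $(x,a)\in D$ in the closed ball of radius $\epsilon$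 around $(\bar x,\bar a)$ (w.r.t. a product metric on $E\times A$). (4) The risk measure $\rho:L^p\to\bar{\mathbb R}$ is law invariant, proper, coherent and has the Fatou property. (5) $\alpha\beta<1$. Let $\underline{\mathbf b}=\frac{1}{1-\alpha\beta}\underline b$, $\bar{\mathbf b}=\frac1{1-\alpha\beta}\bar b$ and let $I=[\underline{\mathbf b},\bar{\mathbf b}]$ be the set of lower semicontinuous functions $v:E\to\mathbb R$ with $\underline{\mathbf b}\le v\le\bar{\mathbf b}$ pointwise. Then the Bellman operator $$\mathcal Tv(x)=\inf_{a\in D(x)}\rho\big(c(x,a,T(x,a,Z))+\beta v(T(x,a,Z))\big),\qquad x\in E,$$ is a contraction on $I$ with modulus $\alpha\beta\in(0,1)$: $\mathcal T$ maps $I$ into $I$, and $\|\mathcal Tv_1-\mathcal Tv_2\|_b\le\alpha\beta\|v_1-v_2\|_b$ for all $v_1,v_2\in I$, where $\|v\|_b=\sup_{x\in E}|v(x)|/b(x)$.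
   Context: Risk measures. Fix a probability space $(\Omega,\mathcal A,\mathbb P)$ and $p\in[1,\infty)$; $L^p=L^p(\Omega,\mathcal A,\mathbb P)$. A risk measure is a map $\rho:L^p\to\bar{\mathbb R}=[-\infty,\infty]$. Monetary: monotone ($X\le Y\Rightarrow\rho(X)\le\rho(Y)$) and translation invariant ($\rho(X+m)=\rho(X)+m$, $m\in\mathbb R$). Coherent: monetary, positive homogeneous ($\rho(\lambda X)=\lambda\rho(X)$ for $\lambda\in\mathbb R_+$) and subadditive ($\rho(X+Y)\le\rho(X)+\rho(Y)$). Proper: never $-\infty$ and $<+\infty$ at at least one point. Law invariant: $\rho(X)=\rho(Y)$ whenever $X,Y$ have the same distribution. Fatou property: for every sequence $(X_n)\subseteq L^p$ with $|X_n|\le Y$ a.s. for some $Y\in L^p$ and $X_n\to X\in L^p$ a.s., $\liminf_n\rho(X_n)\ge\rho(X)$. Stationary decision model. State space $E$ and action space $A$ are (nonempty) Borel spaces (Borel subsets of Polish spaces); $D\subseteq E\times A$ is measurable and contains the graph of a measurable map $E\to A$; $D(x)=\{a:(x,a)\in D\}$; $T:D\times\mathcal Z\to E$ is a measurable transition function; $Z$ is a random element on $(\Omega,\mathcal A,\mathbb P)$ with values in a measurable space $(\mathcal Z,\mathfrak Z)$ (representing the i.i.d. disturbances); $c:D\times E\to\mathbb R$ is the one-stage cost; $\beta\in(0,1]$ is the discount factor. *)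

theory Defs
  imports "HOL-Probability.Probability"
begin

section \<open>Risk measures on \<open>L\<^sup>p\<close>\<close>

text \<open>
  Elements of \<open>L\<^sup>p\<close> are represented by functions instead of a.s.-equivalence classes. A risk measure
  is a map \<open>\<rho>\<close> on all functions of which only the values on \<open>Lp_fun M p\<close> matter. Monotonicity below
  is with respect to the almost sure order, so a monotone \<open>\<rho>\<close> respects a.s.-equality and hence
  is a map on equivalence classes.
\<close>

definition Lp_fun :: "'w measure \<Rightarrow> real \<Rightarrow> ('w \<Rightarrow> real) set" where
  "Lp_fun M p = {X \<in> borel_measurable M. integrable M (\<lambda>\<omega>. \<bar>X \<omega>\<bar> powr p)}"

definition monetary :: "'w measure \<Rightarrow> real \<Rightarrow> (('w \<Rightarrow> real) \<Rightarrow> ereal) \<Rightarrow> bool" where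
  "monetary M p \<rho> \<longleftrightarrow>
     (\<forall>X\<in>Lp_fun M p. \<forall>Y\<in>Lp_fun M p. (AE \<omega> in M. X \<omega> \<le> Y \<omega>) \<longrightarrow> \<rho> X \<le> \<rho> Y) \<and>
     (\<forall>X\<in>Lp_fun M p. \<forall>m::real. \<rho> (\<lambda>\<omega>. X \<omega> + m) = \<rho> X + ereal m)"

text \<open>
  In \<^typ>\<open>ereal\<close>, \<open>0 * \<infinity> = 0\<close>, so positive homogeneity with \<open>\<lambda> = 0\<close> says \<open>\<rho> 0 = 0\<close>. The value of
  \<open>\<infinity> + (-\<infinity>)\<close> in the subadditivity inequality is irrelevant for proper \<open>\<rho>\<close>.
\<close>

definition coherent :: "'w measure \<Rightarrow> real \<Rightarrow> (('w \<Rightarrow> real) \<Rightarrow> ereal) \<Rightarrow> bool" where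
  "coherent M p \<rho> \<longleftrightarrow> monetary M p \<rho> \<and>
     (\<forall>X\<in>Lp_fun M p. \<forall>l::real. 0 \<le> l \<longrightarrow> \<rho> (\<lambda>\<omega>. l * X \<omega>) = ereal l * \<rho> X) \<and>
     (\<forall>X\<in>Lp_fun M p. \<forall>Y\<in>Lp_fun M p. \<rho> (\<lambda>\<omega>. X \<omega> + Y \<omega>) \<le> \<rho> X + \<rho> Y)"

definition proper_risk :: "'w measure \<Rightarrow> real \<Rightarrow> (('w \<Rightarrow> real) \<Rightarrow> ereal) \<Rightarrow> bool" where
  "proper_risk M p \<rho> \<longleftrightarrow>
     (\<forall>X\<in>Lp_fun M p. \<rho> X \<noteq> -\<infinity>) \<and> (\<exists>X\<in>Lp_fun M p. \<rho> X < \<infinity>)"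

definition law_invariant :: "'w measure \<Rightarrow> real \<Rightarrow> (('w \<Rightarrow> real) \<Rightarrow> ereal) \<Rightarrow> bool" where
  "law_invariant M p \<rho> \<longleftrightarrow>
     (\<forall>X\<in>Lp_fun M p. \<forall>Y\<in>Lp_fun M p. distr M borel X = distr M borel Y \<longrightarrow> \<rho> X = \<rho> Y)"

definition Fatou_property :: "'w measure \<Rightarrow> real \<Rightarrow> (('w \<Rightarrow> real) \<Rightarrow> ereal) \<Rightarrow> bool" where
  "Fatou_property M p \<rho> \<longleftrightarrow>
     (\<forall>Xs X. (\<forall>n. Xs n \<in> Lp_fun M p) \<longrightarrow> X \<in> Lp_fun M p \<longrightarrow>
        (\<exists>Y\<in>Lp_fun M p. \<forall>n. AE \<omega> in M. \<bar>Xs n \<omega>\<bar> \<le> Y \<omega>) \<longrightarrow>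
        (AE \<omega> in M. (\<lambda>n. Xs n \<omega>) \<longlonglongrightarrow> X \<omega>) \<longrightarrow>
        \<rho> X \<le> liminf (\<lambda>n. \<rho> (Xs n)))"


section \<open>Semicontinuity\<close>

definition lsc_on :: "'x::topological_space set \<Rightarrow> ('x \<Rightarrow> real) \<Rightarrow> bool" where
  "lsc_on S f \<longleftrightarrow> (\<forall>x\<in>S. ereal (f x) \<le> Liminf (at x within S) (\<lambda>y. ereal (f y)))"

text \<open>
  The section \<open>D(x)\<close> is the image \<open>D `` {x}\<close>. An accumulation point of a sequence in a metric
  space is the limit of a subsequence.
\<close>

definition usc_corr :: "'e::metric_space set \<Rightarrow> ('e \<times> 'a::metric_space) set \<Rightarrow> bool" where
  "usc_corr E D \<longleftrightarrow>
     (\<forall>xs x as. (\<forall>k. xs k \<in> E) \<longrightarrow> x \<in> E \<longrightarrow> xs \<longlonglongrightarrow> x \<longrightarrow> (\<forall>k. as k \<in> D `` {xs k}) \<longrightarrow>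
        (\<exists>a\<in>D `` {x}. \<exists>r::nat \<Rightarrow> nat. strict_mono r \<and> (as \<circ> r) \<longlonglongrightarrow> a))"


section \<open>The stationary decision model\<close>

text \<open>
  \<open>E\<close> and \<open>A\<close> are Borel subsets of Polish spaces, with the relative Borel sigma-algebras.
  All functions with domain \<open>E\<close>, \<open>D \<times> \<Z>\<close> or \<open>D \<times> E\<close> are total in HOL; their values outside these
  sets are unconstrained and never used.
\<close>

locale stationary_model = prob_space M
  for M :: "'w measure" +
  fixes N :: "'z measure"
    and Z :: "'w \<Rightarrow> 'z"
    and E :: "'e::polish_space set"
    and A :: "'a::polish_space set"
    and D :: "('e \<times> 'a) set"
    and T :: "'e \<Rightarrow> 'a \<Rightarrow> 'z \<Rightarrow> 'e"
    and \<beta> :: real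
  assumes E_Borel: "E \<in> sets borel" "E \<noteq> {}"
    and A_Borel: "A \<in> sets borel" "A \<noteq> {}"
    and D_measurable: "D \<in> sets (restrict_space borel E \<Otimes>\<^sub>M restrict_space borel A)"
    and D_graph: "\<exists>f \<in> restrict_space borel E \<rightarrow>\<^sub>M restrict_space borel A. \<forall>x\<in>E. (x, f x) \<in> D"
    and T_measurable: "(\<lambda>((x, a), z). T x a z) \<in>
          restrict_space (restrict_space borel E \<Otimes>\<^sub>M restrict_space borel A) D \<Otimes>\<^sub>M N
            \<rightarrow>\<^sub>M restrict_space borel E"
    and Z_measurable: "Z \<in> M \<rightarrow>\<^sub>M N"
    and discount: "0 < \<beta>" "\<beta> \<le> 1"

definition Bellman ::
  "(('w \<Rightarrow> real) \<Rightarrow> ereal) \<Rightarrow> ('w \<Rightarrow> 'z) \<Rightarrow> ('e \<times> 'a) set \<Rightarrow> ('e \<Rightarrow> 'a \<Rightarrow> 'z \<Rightarrow> 'e) \<Rightarrow>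
   ('e \<Rightarrow> 'a \<Rightarrow> 'e \<Rightarrow> real) \<Rightarrow> real \<Rightarrow> ('e \<Rightarrow> real) \<Rightarrow> 'e \<Rightarrow> ereal" where
  "Bellman \<rho> Z D T c \<beta> v x =
     (INF a \<in> D `` {x}. \<rho> (\<lambda>\<omega>. c x a (T x a (Z \<omega>)) + \<beta> * v (T x a (Z \<omega>))))"

definition lsc_interval ::
  "'e::topological_space set \<Rightarrow> ('e \<Rightarrow> real) \<Rightarrow> ('e \<Rightarrow> real) \<Rightarrow> ('e \<Rightarrow> real) set" where
  "lsc_interval E l u = {v. lsc_on E v \<and> (\<forall>x\<in>E. l x \<le> v x \<and> v x \<le> u x)}"

text \<open>
  The weighted supremum norm takes values in \<^typ>\<open>ereal\<close>, where the supremum exists without any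
  boundedness side condition.
\<close>

definition weighted_norm :: "'e set \<Rightarrow> ('e \<Rightarrow> real) \<Rightarrow> ('e \<Rightarrow> real) \<Rightarrow> ereal" where
  "weighted_norm E b v = (SUP x\<in>E. ereal (\<bar>v x\<bar> / b x))"

end

theory Submission
  imports Defs
begin

text \<open>
  Subadditivity, homogeneity and \<open>\<kappa> = 1 / (1 - \<alpha> * \<beta>) = 1 + \<beta> * \<kappa> * \<alpha>\<close> turn the drift conditions
  into the invariance of the bounds \<open>\<kappa> * b_lo\<close> and \<open>\<kappa> * b_up\<close>, and \<open>v1 \<le> v2 + K * b\<close> into
  \<open>B v1 \<le> B v2 + \<alpha> * \<beta> * K * b\<close>, which is the contraction. By the Fatou property, with the local
  bounds as dominating variables, the risk of the one-step cost is sequentially lower semicontinuous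
  in \<open>(x, a)\<close>; minimising over the compact, upper semicontinuous sections of \<open>D\<close> preserves this.
\<close>

section \<open>Lower semicontinuity\<close>

text \<open>Only real thresholds matter: a real-valued function always exceeds
  \<open>-\<infinity>\<close>, and \<open>\<infinity>\<close> is never below \<open>f x\<close>.
  This trades the extended-real \<open>Liminf\<close> for eventual inequalities between
  reals.\<close>

lemma lsc_on_iff_less:
  "lsc_on S f \<longleftrightarrow> (\<forall>x\<in>S. \<forall>y<f x. \<forall>\<^sub>F z in at x within S. y < f z)"
proof -
  have "ereal (f x) \<le> Liminf (at x within S) (\<lambda>y. ereal (f y)) \<longleftrightarrow>
      (\<forall>y<f x. \<forall>\<^sub>F z in at x within S. y < f z)" for x
  proof
    assume *: "ereal (f x) \<le> Liminf (at x within S) (\<lambda>y. ereal (f y))"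
    show "\<forall>y<f x. \<forall>\<^sub>F z in at x within S. y < f z"
    proof (intro allI impI)
      fix y assume "y < f x"
      with * have "\<forall>\<^sub>F z in at x within S. ereal y < ereal (f z)"
        unfolding le_Liminf_iff by (metis less_ereal.simps(1))
      then show "\<forall>\<^sub>F z in at x within S. y < f z" by simp
    qed
  next
    assume *: "\<forall>y<f x. \<forall>\<^sub>F z in at x within S. y < f z"
    show "ereal (f x) \<le> Liminf (at x within S) (\<lambda>y. ereal (f y))"
      unfolding le_Liminf_iff
    proof (intro allI impI)
      fix y assume "y < ereal (f x)"
      then show "\<forall>\<^sub>F z in at x within S. y < ereal (f z)"
        using * by (cases y) auto
    qed
  qed
  then show ?thesis by (simp add: lsc_on_def)
qed

text \<open>The filter \<open>at x within S\<close> leaves out \<open>x\<close>, but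
  \<open>y < f x\<close> is assumed, so the neighbourhood may include its centre. Compositions need
  this, since \<open>g z\<close> can equal \<open>g x\<close> for \<open>z \<noteq> x\<close>, and
  so do sequences that may hit their limit.\<close>

lemma lsc_on_nbhd:
  assumes "lsc_on S f" "x \<in> S" "y < f x"
  obtains U where "open U" "x \<in> U" "\<And>z. z \<in> U \<Longrightarrow> z \<in> S \<Longrightarrow> y < f z"
  using assms unfolding lsc_on_iff_less eventually_at_topological by metis

lemma lsc_on_compose:
  assumes f: "lsc_on S f" and g: "continuous_on U g" and gU: "g ` U \<subseteq> S"
  shows "lsc_on U (\<lambda>x. f (g x))"
  unfolding lsc_on_iff_less
proof (intro ballI allI impI)
  fix x y assume x: "x \<in> U" and "y < f (g x)"
  then obtain V where V: "open V" "g x \<in> V" "\<And>z. z \<in> V \<Longrightarrow> z \<in> S \<Longrightarrow> y < f z"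
    using lsc_on_nbhd[OF f] gU by blast
  have "(g \<longlongrightarrow> g x) (at x within U)"
    using g x by (simp add: continuous_on_def)
  then have "\<forall>\<^sub>F z in at x within U. g z \<in> V"
    using V by (simp add: topological_tendstoD)
  then show "\<forall>\<^sub>F z in at x within U. y < f (g z)"
    using V(3) gU by (auto simp: eventually_at_filter elim!: eventually_mono)
qed

lemma lsc_on_add:
  assumes "lsc_on S f" "lsc_on S g"
  shows "lsc_on S (\<lambda>x. f x + g x)"
  unfolding lsc_on_iff_less
proof (intro ballI allI impI)
  fix x y assume x: "x \<in> S" and "y < f x + g x"
  \<comment> \<open>\<open>d\<close> is half of the slack, to be spent once on \<open>f\<close> and
    once on \<open>g\<close>.\<close>
  then obtain d where d: "d > 0" "f x + g x - y = 2 * d"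
    by (metis diff_gt_0_iff_gt field_sum_of_halves half_gt_zero mult_2)
  have "\<forall>\<^sub>F z in at x within S. f x - d < f z" "\<forall>\<^sub>F z in at x within S. g x - d < g z"
    using assms x d(1) by (auto simp: lsc_on_iff_less)
  then show "\<forall>\<^sub>F z in at x within S. y < f z + g z"
    by eventually_elim (use d in linarith)
qed

lemma lsc_on_cmult:
  fixes k :: real
  assumes "0 < k" "lsc_on S f"
  shows "lsc_on S (\<lambda>x. k * f x)"
  unfolding lsc_on_iff_less
proof (intro ballI allI impI)
  fix x y assume x: "x \<in> S" and "y < k * f x"
  then have "y / k < f x" using assms(1) by (simp add: field_simps)
  then have "\<forall>\<^sub>F z in at x within S. y / k < f z"
    using assms(2) x by (auto simp: lsc_on_iff_less)
  then show "\<forall>\<^sub>F z in at x within S. y < k * f z"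
    by eventually_elim (use assms(1) in \<open>simp add: field_simps\<close>)
qed

lemma lsc_on_sequentially:
  assumes f: "lsc_on S f" and x: "x \<in> S" "\<And>n. xs n \<in> S" "xs \<longlonglongrightarrow> x" and y: "y < f x"
  shows "\<forall>\<^sub>F n in sequentially. y < f (xs n)"
proof -
  obtain U where U: "open U" "x \<in> U" "\<And>z. z \<in> U \<Longrightarrow> z \<in> S \<Longrightarrow> y < f z"
    using lsc_on_nbhd[OF f x(1) y] by blast
  have "\<forall>\<^sub>F n in sequentially. xs n \<in> U"
    using x(3) U by (simp add: topological_tendstoD)
  then show ?thesis
    using U(3) x(2) by (auto elim: eventually_mono)
qed

text \<open>Strict superlevel sets are relatively open; \<open>W\<close> below is the largest open
  set witnessing this. Costs and value functions are given only as semicontinuous, and this is what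
  makes them measurable.\<close>

lemma lsc_on_borel_measurable:
  assumes "lsc_on S f"
  shows "f \<in> borel_measurable (restrict_space borel S)"
  unfolding borel_measurable_iff_greater
proof
  fix y
  define W where "W = \<Union>{U. open U \<and> (\<forall>z\<in>U \<inter> S. y < f z)}"
  have "{w \<in> space (restrict_space borel S). y < f w} = S \<inter> W"
  proof safe
    fix x assume "x \<in> space (restrict_space borel S)" "y < f x"
    then have x: "x \<in> S" "y < f x" by (auto simp: space_restrict_space)
    obtain U where "open U" "x \<in> U" "\<And>z. z \<in> U \<Longrightarrow> z \<in> S \<Longrightarrow> y < f z"
      using lsc_on_nbhd[OF assms x] by blast
    then show "x \<in> W" unfolding W_def by blast
  qed (auto simp: W_def space_restrict_space)
  moreover have "W \<in> sets borel" unfolding W_def by (intro borel_open open_Union) auto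
  ultimately show "{w \<in> space (restrict_space borel S). y < f w} \<in> sets (restrict_space borel S)"
    by (auto simp: sets_restrict_space)
qed

text \<open>One half of Berge's maximum theorem.\<close>

lemma lsc_on_INF_usc_corr:
  fixes D :: "('e::metric_space \<times> 'a::metric_space) set" and J :: "'e \<times> 'a \<Rightarrow> ereal"
  assumes D: "usc_corr E D"
    and J: "\<And>q qs. q \<in> D \<Longrightarrow> (\<And>n. qs n \<in> D) \<Longrightarrow> qs \<longlonglongrightarrow> q \<Longrightarrow> J q \<le> liminf (\<lambda>n. J (qs n))"
    and fin: "\<And>x. x \<in> E \<Longrightarrow> \<bar>INF a\<in>D `` {x}. J (x, a)\<bar> \<noteq> \<infinity>"
  shows "lsc_on E (\<lambda>x. real_of_ereal (INF a\<in>D `` {x}. J (x, a)))"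
  unfolding lsc_on_iff_less
proof (intro ballI allI impI)
  define V where "V x = (INF a\<in>D `` {x}. J (x, a))" for x
  have V: "ereal (real_of_ereal (V x)) = V x" if "x \<in> E" for x
    using fin[OF that] by (simp add: V_def ereal_real')
  fix x y assume x: "x \<in> E" and "y < real_of_ereal (INF a\<in>D `` {x}. J (x, a))"
  then have y: "ereal y < V x"
    using V[OF x] by (metis V_def less_ereal.simps(1))
  \<comment> \<open>The infimum need not be attained, hence the intermediate value: where
    \<open>V\<close> is at most \<open>y\<close> there are actions with \<open>J\<close> below
    \<open>y'\<close>, and \<open>y'\<close> is still strictly under \<open>V x\<close>.\<close>
  then obtain y' where y': "ereal y < y'" "y' < V x" using dense by blast
  have "\<forall>\<^sub>F z in at x within E. y < real_of_ereal (V z)"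
  \<comment> \<open>Filters are traded for sequences, the language of
    \<open>usc_corr\<close>.\<close>
  proof (rule sequentially_imp_eventually_within, safe)
    fix f assume f: "\<forall>n. f n \<in> E \<and> f n \<noteq> x" and lim: "f \<longlonglongrightarrow> x"
    show "\<forall>\<^sub>F n in sequentially. y < real_of_ereal (V (f n))"
    proof (rule ccontr)
      assume "\<not> ?thesis"
      then obtain r :: "nat \<Rightarrow> nat" where r: "strict_mono r" "\<And>n. real_of_ereal (V (f (r n))) \<le> y"
        by (metis not_eventually_sequentiallyD not_less)
      have "V (f (r n)) < y'" for n
        using r(2)[of n] V[of "f (r n)"] f y'(1) by (metis ereal_less_eq(3) le_less_trans)
      then have "\<exists>a. a \<in> D `` {f (r n)} \<and> J (f (r n), a) < y'" for n
        unfolding V_def INF_less_iff by blast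
      then obtain as where as: "\<And>n. as n \<in> D `` {f (r n)}" "\<And>n. J (f (r n), as n) < y'" by metis
      have fr: "(f \<circ> r) \<longlonglongrightarrow> x" using lim r(1) by (rule LIMSEQ_subseq_LIMSEQ)
      \<comment> \<open>Upper semicontinuity of the sections extracts from the near-minimising
        actions a limit that is admissible at \<open>x\<close>.\<close>
      obtain a s where a: "a \<in> D `` {x}" and s: "strict_mono (s :: nat \<Rightarrow> nat)" and as_lim: "(as \<circ> s) \<longlonglongrightarrow> a"
        using D[unfolded usc_corr_def, rule_format, of "f \<circ> r" x as] f x fr as(1) by auto
      define qs where "qs n = (f (r (s n)), as (s n))" for n
      have "(f \<circ> r \<circ> s) \<longlonglongrightarrow> x" using fr s by (rule LIMSEQ_subseq_LIMSEQ)
      then have "qs \<longlonglongrightarrow> (x, a)"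
        using as_lim unfolding qs_def comp_def by (rule tendsto_Pair)
      moreover have "qs n \<in> D" for n using as(1) by (auto simp: qs_def)
      ultimately have "J (x, a) \<le> liminf (\<lambda>n. J (qs n))" using J a by blast
      also have "\<dots> \<le> limsup (\<lambda>n. J (qs n))" by (simp add: Liminf_le_Limsup)
      also have "\<dots> \<le> y'"
        using as(2) by (intro Limsup_bounded) (auto simp: qs_def less_imp_le)
      finally have "J (x, a) \<le> y'" .
      moreover have "V x \<le> J (x, a)" unfolding V_def using a by (rule INF_lower)
      ultimately show False using y'(2) by simp
    qed
  qed
  then show "\<forall>\<^sub>F z in at x within E. y < real_of_ereal (INF a\<in>D `` {z}. J (z, a))"
    by (simp add: V_def)
qed

section \<open>Coherent risk measures on \<open>L\<^sup>p\<close>\<close>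

lemma Lp_fun_bounded:
  assumes "0 \<le> p" "g \<in> Lp_fun M p" "f \<in> borel_measurable M"
    and "\<And>\<omega>. \<omega> \<in> space M \<Longrightarrow> \<bar>f \<omega>\<bar> \<le> g \<omega>"
  shows "f \<in> Lp_fun M p"
proof -
  have "integrable M (\<lambda>\<omega>. \<bar>f \<omega>\<bar> powr p)"
  proof (rule Bochner_Integration.integrable_bound)
    show "integrable M (\<lambda>\<omega>. \<bar>g \<omega>\<bar> powr p)" using assms(2) by (simp add: Lp_fun_def)
    show "AE \<omega> in M. norm (\<bar>f \<omega>\<bar> powr p) \<le> norm (\<bar>g \<omega>\<bar> powr p)"
    proof (rule AE_I2)
      fix \<omega> assume "\<omega> \<in> space M"
      then have "\<bar>f \<omega>\<bar> \<le> \<bar>g \<omega>\<bar>" using assms(4) by fastforce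
      then show "norm (\<bar>f \<omega>\<bar> powr p) \<le> norm (\<bar>g \<omega>\<bar> powr p)"
        using assms(1) by (simp add: powr_mono2)
    qed
  qed (use assms(3) in measurable)
  then show ?thesis using assms(3) by (simp add: Lp_fun_def)
qed

lemma Lp_fun_cmult:
  fixes k :: real
  assumes "f \<in> Lp_fun M p"
  shows "(\<lambda>\<omega>. k * f \<omega>) \<in> Lp_fun M p"
  using assms by (auto simp: Lp_fun_def abs_mult powr_mult)

lemma Lp_fun_add:
  assumes p: "0 \<le> p" and f: "f \<in> Lp_fun M p" and g: "g \<in> Lp_fun M p"
  shows "(\<lambda>\<omega>. f \<omega> + g \<omega>) \<in> Lp_fun M p"
proof -
  have meas[measurable]: "f \<in> borel_measurable M" "g \<in> borel_measurable M"
    using f g by (auto simp: Lp_fun_def)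
  have "integrable M (\<lambda>\<omega>. \<bar>f \<omega> + g \<omega>\<bar> powr p)"
  proof (rule Bochner_Integration.integrable_bound)
    show "integrable M (\<lambda>\<omega>. 2 powr p * (\<bar>f \<omega>\<bar> powr p + \<bar>g \<omega>\<bar> powr p))"
      using f g by (simp add: Lp_fun_def)
    \<comment> \<open>A crude constant suffices: the sum is at most twice the larger summand, and
      the power of the maximum is one of the two powers.\<close>
    have "\<bar>a + b\<bar> powr p \<le> 2 powr p * (\<bar>a\<bar> powr p + \<bar>b\<bar> powr p)" for a b :: real
    proof -
      have "\<bar>a + b\<bar> powr p \<le> (2 * max \<bar>a\<bar> \<bar>b\<bar>) powr p" using p by (intro powr_mono2) auto
      also have "\<dots> = 2 powr p * max \<bar>a\<bar> \<bar>b\<bar> powr p" by (simp add: powr_mult)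
      also have "\<dots> \<le> 2 powr p * (\<bar>a\<bar> powr p + \<bar>b\<bar> powr p)"
        by (intro mult_left_mono) (auto simp: max_def)
      finally show ?thesis .
    qed
    then show "AE \<omega> in M. norm (\<bar>f \<omega> + g \<omega>\<bar> powr p) \<le> norm (2 powr p * (\<bar>f \<omega>\<bar> powr p + \<bar>g \<omega>\<bar> powr p))"
      by simp
  qed measurable
  then show ?thesis by (simp add: Lp_fun_def)
qed

lemma (in finite_measure) Lp_fun_const: "(\<lambda>\<omega>. k) \<in> Lp_fun M p"
  by (simp add: Lp_fun_def)

lemma monetary_mono:
  assumes "monetary M p \<rho>" "X \<in> Lp_fun M p" "Y \<in> Lp_fun M p" "\<And>\<omega>. \<omega> \<in> space M \<Longrightarrow> X \<omega> \<le> Y \<omega>"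
  shows "\<rho> X \<le> \<rho> Y"
  using assms unfolding monetary_def by blast

lemma coherent_cmult:
  "coherent M p \<rho> \<Longrightarrow> X \<in> Lp_fun M p \<Longrightarrow> 0 \<le> l \<Longrightarrow> \<rho> (\<lambda>\<omega>. l * X \<omega>) = ereal l * \<rho> X"
  by (simp add: coherent_def)

lemma coherent_subadd:
  "coherent M p \<rho> \<Longrightarrow> X \<in> Lp_fun M p \<Longrightarrow> Y \<in> Lp_fun M p \<Longrightarrow> \<rho> (\<lambda>\<omega>. X \<omega> + Y \<omega>) \<le> \<rho> X + \<rho> Y"
  by (simp add: coherent_def)

text \<open>Homogeneity with factor \<open>0\<close> gives \<open>\<rho> 0 = 0\<close>, because
  \<open>0\<close> times any \<open>ereal\<close> is \<open>0\<close>; translation by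
  \<open>k\<close> does the rest.\<close>

lemma (in finite_measure) coherent_const:
  assumes "coherent M p \<rho>"
  shows "\<rho> (\<lambda>\<omega>. k) = ereal k"
proof -
  have *: "\<forall>X\<in>Lp_fun M p. \<forall>m. \<rho> (\<lambda>\<omega>. X \<omega> + m) = \<rho> X + ereal m"
    using assms unfolding coherent_def monetary_def by blast
  have "\<rho> (\<lambda>\<omega>. 0) = 0"
    using coherent_cmult[OF assms Lp_fun_const[of 0], of 0] by (simp flip: zero_ereal_def)
  moreover have "\<rho> (\<lambda>\<omega>. 0 + k) = \<rho> (\<lambda>\<omega>. 0) + ereal k"
    by (rule spec[OF bspec[OF * Lp_fun_const[of 0 p]], of k])
  ultimately show ?thesis by simp
qed

text \<open>The sequence \<open>min (h q) (h (qs n))\<close> converges to \<open>h q\<close>, so that the Fatou property applies,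
  and monotonicity compares it with \<open>h (qs n)\<close>.\<close>

lemma Fatou_property_lsc:
  fixes h :: "'x::metric_space \<Rightarrow> 'w \<Rightarrow> real"
  assumes p: "0 \<le> p" and mon: "monetary M p \<rho>" and Fatou: "Fatou_property M p \<rho>"
    and meas: "\<And>q. q \<in> S \<Longrightarrow> h q \<in> borel_measurable M"
    and lsc: "\<And>\<omega>. \<omega> \<in> space M \<Longrightarrow> lsc_on S (\<lambda>q. h q \<omega>)"
    and bound: "Y \<in> Lp_fun M p" "0 < \<epsilon>"
      "\<And>\<omega> r. \<omega> \<in> space M \<Longrightarrow> r \<in> S \<inter> cball q \<epsilon> \<Longrightarrow> \<bar>h r \<omega>\<bar> \<le> Y \<omega>"
    and q: "q \<in> S" "\<And>n. qs n \<in> S" "qs \<longlonglongrightarrow> q"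
  shows "\<rho> (h q) \<le> liminf (\<lambda>n. \<rho> (h (qs n)))"
proof -
  \<comment> \<open>Domination by \<open>Y\<close> is available only inside the ball, so the first
    \<open>k\<close> terms are dropped; the \<open>liminf\<close> does not see them.\<close>
  obtain k where k: "\<And>n. k \<le> n \<Longrightarrow> dist (qs n) q < \<epsilon>"
    using q(3) bound(2) unfolding lim_sequentially by blast
  define rs where "rs n = qs (n + k)" for n
  have rs: "rs n \<in> S \<inter> cball q \<epsilon>" for n
    using q(2) k[of "n + k"] by (auto simp: rs_def dist_commute less_imp_le)
  have rs_lim: "rs \<longlonglongrightarrow> q" unfolding rs_def using q(3) by (rule LIMSEQ_ignore_initial_segment)
  have qS: "q \<in> S \<inter> cball q \<epsilon>" using q(1) bound(2) by simp
  have Lp: "h r \<in> Lp_fun M p" if "r \<in> S \<inter> cball q \<epsilon>" for r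
    using Lp_fun_bounded[OF p bound(1) meas] bound(3) that by blast
  define W where "W n \<omega> = min (h q \<omega>) (h (rs n) \<omega>)" for n \<omega>
  have W_bound: "\<bar>W n \<omega>\<bar> \<le> Y \<omega>" if "\<omega> \<in> space M" for n \<omega>
    using bound(3)[OF that rs] bound(3)[OF that qS] by (auto simp: W_def min_def)
  have W_Lp: "W n \<in> Lp_fun M p" for n
  proof (rule Lp_fun_bounded[OF p bound(1) _ W_bound])
    show "W n \<in> borel_measurable M"
      unfolding W_def using meas[OF q(1)] meas[of "rs n"] rs by (intro borel_measurable_min) auto
  qed
  have W_lim: "(\<lambda>n. W n \<omega>) \<longlonglongrightarrow> h q \<omega>" if "\<omega> \<in> space M" for \<omega>
  proof (rule order_tendstoI)
    fix y assume "y < h q \<omega>"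
    then have "\<forall>\<^sub>F n in sequentially. y < h (rs n) \<omega>"
      using lsc_on_sequentially[OF lsc[OF that] q(1) _ rs_lim] rs by blast
    then show "\<forall>\<^sub>F n in sequentially. y < W n \<omega>"
      by eventually_elim (use \<open>y < h q \<omega>\<close> in \<open>simp add: W_def\<close>)
  next
    \<comment> \<open>Semicontinuity gives only the lower half of the convergence; capping at
      \<open>h q\<close> supplies the upper half.\<close>
    fix y assume "h q \<omega> < y"
    then show "\<forall>\<^sub>F n in sequentially. W n \<omega> < y"
      by (simp add: W_def min_less_iff_disj)
  qed
  have "\<rho> (h q) \<le> liminf (\<lambda>n. \<rho> (W n))"
  proof (rule Fatou[unfolded Fatou_property_def, rule_format])
    show "\<exists>Y\<in>Lp_fun M p. \<forall>n. AE \<omega> in M. \<bar>W n \<omega>\<bar> \<le> Y \<omega>"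
      using bound(1) W_bound by (intro bexI[of _ Y]) auto
  qed (use W_Lp Lp[OF qS] W_lim in auto)
  also have "\<dots> \<le> liminf (\<lambda>n. \<rho> (h (rs n)))"
    by (intro Liminf_mono always_eventually allI monetary_mono[OF mon W_Lp Lp[OF rs]])
      (simp add: W_def)
  also have "\<dots> = liminf (\<lambda>n. \<rho> (h (qs n)))"
    unfolding rs_def using liminf_shift_k[of "\<lambda>n. \<rho> (h (qs n))" k] by simp
  finally show ?thesis .
qed

section \<open>The Bellman operator\<close>

theorem lemma5p4:
  fixes M :: "'w measure" and N :: "'z measure" and Z :: "'w \<Rightarrow> 'z"
    and E :: "'e::polish_space set" and A :: "'a::polish_space set" and D :: "('e \<times> 'a) set"
    and T :: "'e \<Rightarrow> 'a \<Rightarrow> 'z \<Rightarrow> 'e" and c :: "'e \<Rightarrow> 'a \<Rightarrow> 'e \<Rightarrow> real"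
    and p \<alpha> \<beta> eps_lo eps_up :: real and b_lo b_up b :: "'e \<Rightarrow> real"
    and \<rho> :: "('w \<Rightarrow> real) \<Rightarrow> ereal"
  defines "b \<equiv> (\<lambda>x. b_up x - b_lo x)"
  assumes p: "1 \<le> p"
    and model: "stationary_model M N Z E A D T \<beta>"
    and D_compact: "\<forall>x\<in>E. compact (D `` {x})"
    and D_usc: "usc_corr E D"
    and T_cont: "\<forall>z\<in>space N. continuous_on D (\<lambda>(x, a). T x a z)"
    and c_lsc: "lsc_on (D \<times> E) (\<lambda>((x, a), y). c x a y)"
    and nonneg: "0 \<le> \<alpha>" "0 \<le> eps_lo" "0 \<le> eps_up"
    and eps_sum: "eps_lo + eps_up = 1"
    and b_lo_meas: "b_lo \<in> borel_measurable (restrict_space borel E)"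
    and b_up_meas: "b_up \<in> borel_measurable (restrict_space borel E)"
    and b_lo_range: "\<forall>x\<in>E. b_lo x \<le> - eps_lo"
    and b_up_range: "\<forall>x\<in>E. eps_up \<le> b_up x"
    and lower1: "\<forall>(x, a)\<in>D. ereal (b_lo x) \<le> \<rho> (\<lambda>\<omega>. c x a (T x a (Z \<omega>)))"
    and lower2: "\<forall>(x, a)\<in>D. \<rho> (\<lambda>\<omega>. - b_lo (T x a (Z \<omega>))) \<le> ereal (- \<alpha> * b_lo x)"
    and upper1: "\<forall>(x, a)\<in>D. \<rho> (\<lambda>\<omega>. c x a (T x a (Z \<omega>))) \<le> ereal (b_up x)"
    and upper2: "\<forall>(x, a)\<in>D. \<rho> (\<lambda>\<omega>. b_up (T x a (Z \<omega>))) \<le> ereal (\<alpha> * b_up x)"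
    and local_bound: "\<forall>q\<in>D. \<exists>\<epsilon>>0. \<exists>\<Theta>1 \<in> borel_measurable N. \<exists>\<Theta>2 \<in> borel_measurable N.
        (\<forall>z\<in>space N. 0 \<le> \<Theta>1 z \<and> 0 \<le> \<Theta>2 z) \<and>
        (\<lambda>\<omega>. \<Theta>1 (Z \<omega>)) \<in> Lp_fun M p \<and> (\<lambda>\<omega>. \<Theta>2 (Z \<omega>)) \<in> Lp_fun M p \<and>
        (\<forall>z\<in>space N. \<forall>(x, a) \<in> D \<inter> cball q \<epsilon>.
           \<bar>c x a (T x a z)\<bar> \<le> \<Theta>1 z \<and> b (T x a z) \<le> \<Theta>2 z)"
    and risk: "law_invariant M p \<rho>" "proper_risk M p \<rho>" "coherent M p \<rho>" "Fatou_property M p \<rho>"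
    and contr: "\<alpha> * \<beta> < 1"
  defines "I \<equiv> lsc_interval E (\<lambda>x. 1 / (1 - \<alpha> * \<beta>) * b_lo x) (\<lambda>x. 1 / (1 - \<alpha> * \<beta>) * b_up x)"
    and "B \<equiv> Bellman \<rho> Z D T c \<beta>"
  shows "\<alpha> * \<beta> \<in> {0<..<1} \<and>
    (\<forall>v\<in>I. (\<forall>x\<in>E. \<bar>B v x\<bar> \<noteq> \<infinity>) \<and> (\<lambda>x. real_of_ereal (B v x)) \<in> I) \<and>
    (\<forall>v1\<in>I. \<forall>v2\<in>I.
       weighted_norm E b (\<lambda>x. real_of_ereal (B v1 x) - real_of_ereal (B v2 x))
         \<le> ereal (\<alpha> * \<beta>) * weighted_norm E b (\<lambda>x. v1 x - v2 x))"
proof -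
  interpret stationary_model M N Z E A D T \<beta> by (rule model)
  define \<kappa> where "\<kappa> = 1 / (1 - \<alpha> * \<beta>)"
  have \<kappa>: "0 < \<kappa>" "\<kappa> = 1 + \<beta> * \<kappa> * \<alpha>"
    using contr by (simp_all add: \<kappa>_def field_simps)
  have \<beta>\<kappa>: "0 \<le> \<beta> * \<kappa>" using \<kappa>(1) discount by simp
  have p0: "0 \<le> p" using p by simp
  have coh: "coherent M p \<rho>" and mon: "monetary M p \<rho>" and Fatou: "Fatou_property M p \<rho>"
    using risk by (auto simp: coherent_def)

  \<comment> \<open>Measurability and integrability along one transition\<close>
  have D_sub: "x \<in> E \<and> a \<in> A" if "(x, a) \<in> D" for x a
    using sets.sets_into_space[OF D_measurable] that
    by (auto simp: space_pair_measure space_restrict_space)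
  have D_ne: "D `` {x} \<noteq> {}" if "x \<in> E" for x
    using D_graph that by auto
  have ZN: "Z \<omega> \<in> space N" if "\<omega> \<in> space M" for \<omega>
    using measurable_space[OF Z_measurable that] .
  have T_meas: "T x a \<in> N \<rightarrow>\<^sub>M restrict_space borel E" if "(x, a) \<in> D" for x a
    using measurable_compose[OF measurable_Pair1' T_measurable, of "(x, a)"] that D_sub
    by (auto simp: space_pair_measure space_restrict_space)
  have TE: "T x a z \<in> E" if "(x, a) \<in> D" "z \<in> space N" for x a z
    using measurable_space[OF T_meas[OF that(1)] that(2)] by (simp add: space_restrict_space)
  have TZ_meas: "(\<lambda>\<omega>. w (T x a (Z \<omega>))) \<in> borel_measurable M"
    if "(x, a) \<in> D" "w \<in> borel_measurable (restrict_space borel E)" for x a and w :: "'e \<Rightarrow> real"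
    using measurable_compose[OF Z_measurable measurable_compose[OF T_meas[OF that(1)] that(2)]] .
  \<comment> \<open>\<open>eps_lo + eps_up = 1\<close> bounds \<open>b\<close> away from zero, and
    the signs of \<open>b_lo\<close> and \<open>b_up\<close> let \<open>b\<close> dominate
    both.\<close>
  have b_ge1: "1 \<le> b y" and b_bounds: "\<bar>b_lo y\<bar> \<le> b y" "\<bar>b_up y\<bar> \<le> b y"
    and b_sgn: "b_lo y \<le> 0" "0 \<le> b_up y" if "y \<in> E" for y
    using b_lo_range b_up_range nonneg eps_sum that by (force simp: b_def)+
  have b_meas: "b \<in> borel_measurable (restrict_space borel E)"
    unfolding b_def using b_lo_meas b_up_meas by measurable

  have bT_Lp: "(\<lambda>\<omega>. b (T x a (Z \<omega>))) \<in> Lp_fun M p" if q: "(x, a) \<in> D" for x a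
  proof -
    obtain \<epsilon> \<Theta> where \<epsilon>: "\<epsilon> > 0" and \<Theta>: "(\<lambda>\<omega>. \<Theta> (Z \<omega>)) \<in> Lp_fun M p"
      and le: "\<forall>z\<in>space N. \<forall>(x', a') \<in> D \<inter> cball (x, a) \<epsilon>. b (T x' a' z) \<le> \<Theta> z"
      using local_bound q by (fast dest: bspec)
    \<comment> \<open>The centre belongs to its own ball, so the local bound applies at
      \<open>(x, a)\<close> itself.\<close>
    have "(x, a) \<in> D \<inter> cball (x, a) \<epsilon>" using q \<epsilon> by simp
    then have "\<bar>b (T x a (Z \<omega>))\<bar> \<le> \<Theta> (Z \<omega>)" if "\<omega> \<in> space M" for \<omega>
      using le ZN[OF that] b_ge1[OF TE[OF q ZN[OF that]]] by fastforce
    then show ?thesis using Lp_fun_bounded[OF p0 \<Theta> TZ_meas[OF q b_meas]] by blast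
  qed
  have TZ_Lp: "(\<lambda>\<omega>. w (T x a (Z \<omega>))) \<in> Lp_fun M p"
    if "(x, a) \<in> D" "w \<in> borel_measurable (restrict_space borel E)"
      and "\<And>y. y \<in> E \<Longrightarrow> \<bar>w y\<bar> \<le> k * b y" for x a k and w :: "'e \<Rightarrow> real"
    using Lp_fun_bounded[OF p0 Lp_fun_cmult[OF bT_Lp[OF that(1)]] TZ_meas[OF that(1,2)], of k]
      that(3)[OF TE[OF that(1) ZN]] by blast
  have c_meas: "c x a \<in> borel_measurable (restrict_space borel E)" if "(x, a) \<in> D" for x a
  proof -
    \<comment> \<open>Freezing \<open>(x, a)\<close> composes \<open>c\<close> with the continuous
      map \<open>y \<mapsto> ((x, a), y)\<close>, so the section is semicontinuous and hence
      Borel.\<close>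
    have "lsc_on E (\<lambda>y. (\<lambda>((x, a), y). c x a y) ((x, a), y))"
      using that by (intro lsc_on_compose[OF c_lsc] continuous_intros) auto
    then show ?thesis by (auto dest: lsc_on_borel_measurable)
  qed
  have cT_Lp: "(\<lambda>\<omega>. c x a (T x a (Z \<omega>))) \<in> Lp_fun M p" if q: "(x, a) \<in> D" for x a
  proof -
    obtain \<epsilon> \<Theta> where \<epsilon>: "\<epsilon> > 0" and \<Theta>: "(\<lambda>\<omega>. \<Theta> (Z \<omega>)) \<in> Lp_fun M p"
      and le: "\<forall>z\<in>space N. \<forall>(x', a') \<in> D \<inter> cball (x, a) \<epsilon>. \<bar>c x' a' (T x' a' z)\<bar> \<le> \<Theta> z"
      using local_bound q by (fast dest: bspec)
    have "(x, a) \<in> D \<inter> cball (x, a) \<epsilon>" using q \<epsilon> by simp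
    then have "\<bar>c x a (T x a (Z \<omega>))\<bar> \<le> \<Theta> (Z \<omega>)" if "\<omega> \<in> space M" for \<omega>
      using le ZN[OF that] by fastforce
    then show ?thesis using Lp_fun_bounded[OF p0 \<Theta> TZ_meas[OF q c_meas[OF q]]] by blast
  qed
  have lo_Lp: "(\<lambda>\<omega>. - b_lo (T x a (Z \<omega>))) \<in> Lp_fun M p"
    and up_Lp: "(\<lambda>\<omega>. b_up (T x a (Z \<omega>))) \<in> Lp_fun M p" if "(x, a) \<in> D" for x a
    using TZ_Lp[OF that, of "\<lambda>y. - b_lo y" 1] TZ_Lp[OF that, of b_up 1]
      b_lo_meas b_up_meas b_bounds by auto
  \<comment> \<open>Both drift conditions combine into one for \<open>b\<close>; its factor
    \<open>\<alpha>\<close>, multiplied by \<open>\<beta>\<close>, becomes the contraction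
    modulus.\<close>
  have \<rho>_b: "\<rho> (\<lambda>\<omega>. b (T x a (Z \<omega>))) \<le> ereal (\<alpha> * b x)" if q: "(x, a) \<in> D" for x a
  proof -
    have "\<rho> (\<lambda>\<omega>. b_up (T x a (Z \<omega>)) + - b_lo (T x a (Z \<omega>)))
        \<le> \<rho> (\<lambda>\<omega>. b_up (T x a (Z \<omega>))) + \<rho> (\<lambda>\<omega>. - b_lo (T x a (Z \<omega>)))"
      using coherent_subadd[OF coh up_Lp[OF q] lo_Lp[OF q]] .
    also have "\<dots> \<le> ereal (\<alpha> * b_up x) + ereal (- \<alpha> * b_lo x)"
      using upper2 lower2 q by (intro add_mono) auto
    also have "\<dots> = ereal (\<alpha> * b x)" by (simp add: b_def algebra_simps)
    finally show ?thesis by (simp add: b_def)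
  qed

  \<comment> \<open>Positivity of the modulus\<close>
  have \<alpha>_pos: "0 < \<alpha>"
  proof -
    obtain x a where q: "(x, a) \<in> D" using E_Borel D_ne by blast
    \<comment> \<open>The constant \<open>1\<close> has risk \<open>1\<close> and lies below
      \<open>b\<close>, so the drift of \<open>b\<close> with \<open>\<alpha> = 0\<close> would give
      \<open>1 \<le> 0\<close>.\<close>
    have "ereal 1 = \<rho> (\<lambda>\<omega>. 1)" using coherent_const[OF coh] by simp
    also have "\<dots> \<le> \<rho> (\<lambda>\<omega>. b (T x a (Z \<omega>)))"
      using b_ge1[OF TE[OF q ZN]] by (intro monetary_mono[OF mon Lp_fun_const bT_Lp[OF q]])
    also have "\<dots> \<le> ereal (\<alpha> * b x)" using \<rho>_b[OF q] .
    finally have "1 \<le> \<alpha> * b x" by simp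
    then show ?thesis using nonneg(1) by (cases "\<alpha> = 0") auto
  qed

  \<comment> \<open>Invariance of the bounds under the Bellman operator\<close>
  have I_iff: "v \<in> I \<longleftrightarrow> lsc_on E v \<and> (\<forall>x\<in>E. \<kappa> * b_lo x \<le> v x \<and> v x \<le> \<kappa> * b_up x)" for v
    by (simp add: I_def lsc_interval_def \<kappa>_def)
  \<comment> \<open>State and action form one argument \<open>q\<close>, so that semicontinuity on
    \<open>D\<close> can be stated.\<close>
  define h where "h v q \<omega> = c (fst q) (snd q) (T (fst q) (snd q) (Z \<omega>))
      + \<beta> * v (T (fst q) (snd q) (Z \<omega>))" for v q \<omega>
  have B_eq: "B v x = (INF a\<in>D `` {x}. \<rho> (h v (x, a)))" for v x
    by (simp add: B_def Bellman_def h_def[abs_def])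
  \<comment> \<open>As \<open>b_lo \<le> 0 \<le> b_up\<close>, the two one-sided bounds yield a
    symmetric one in terms of \<open>b\<close>, the form that domination requires.\<close>
  have v_abs: "\<bar>v y\<bar> \<le> \<kappa> * b y" if "v \<in> I" "y \<in> E" for v y
  proof -
    have "\<kappa> * b_lo y \<le> v y" "v y \<le> \<kappa> * b_up y" using that I_iff by auto
    moreover have "\<kappa> * b_lo y \<le> 0" "0 \<le> \<kappa> * b_up y"
      using \<kappa>(1) b_sgn[OF that(2)] by (simp_all add: mult_nonneg_nonpos)
    moreover have "\<kappa> * b y = \<kappa> * b_up y - \<kappa> * b_lo y" by (simp add: b_def algebra_simps)
    ultimately show ?thesis by linarith
  qed
  have v_Lp: "(\<lambda>\<omega>. v (T x a (Z \<omega>))) \<in> Lp_fun M p" if "v \<in> I" "(x, a) \<in> D" for v x a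
    using TZ_Lp[OF that(2)] v_abs[OF that(1)] that(1) by (auto simp: I_iff dest: lsc_on_borel_measurable)
  have h_Lp: "h v q \<in> Lp_fun M p" if "v \<in> I" "q \<in> D" for v q
    unfolding h_def using that by (intro Lp_fun_add[OF p0] Lp_fun_cmult cT_Lp v_Lp) auto

  have \<rho>_upper: "\<rho> (h v (x, a)) \<le> ereal (\<kappa> * b_up x)" if v: "v \<in> I" and q: "(x, a) \<in> D" for v x a
  proof -
    \<comment> \<open>\<open>?R\<close> is the discounted continuation with \<open>v\<close> raised
      to its upper bound.\<close>
    let ?R = "\<lambda>\<omega>. (\<beta> * \<kappa>) * b_up (T x a (Z \<omega>))"
    have R: "?R \<in> Lp_fun M p" using up_Lp[OF q] by (rule Lp_fun_cmult)
    have "\<rho> (h v (x, a)) \<le> \<rho> (\<lambda>\<omega>. c x a (T x a (Z \<omega>)) + ?R \<omega>)"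
    proof (rule monetary_mono[OF mon h_Lp[OF v q] Lp_fun_add[OF p0 cT_Lp[OF q] R]])
      fix \<omega> assume "\<omega> \<in> space M"
      then have "v (T x a (Z \<omega>)) \<le> \<kappa> * b_up (T x a (Z \<omega>))" using v TE[OF q ZN] I_iff by blast
      then show "h v (x, a) \<omega> \<le> c x a (T x a (Z \<omega>)) + ?R \<omega>"
        using discount by (simp add: h_def mult.assoc)
    qed
    also have "\<dots> \<le> \<rho> (\<lambda>\<omega>. c x a (T x a (Z \<omega>))) + \<rho> ?R"
      using coherent_subadd[OF coh cT_Lp[OF q] R] .
    also have "\<rho> ?R = ereal (\<beta> * \<kappa>) * \<rho> (\<lambda>\<omega>. b_up (T x a (Z \<omega>)))"
      using coherent_cmult[OF coh up_Lp[OF q] \<beta>\<kappa>] .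
    also have "\<rho> (\<lambda>\<omega>. c x a (T x a (Z \<omega>))) + \<dots>
        \<le> ereal (b_up x) + ereal (\<beta> * \<kappa>) * ereal (\<alpha> * b_up x)"
      using upper1 upper2 q \<beta>\<kappa> by (intro add_mono ereal_mult_left_mono) auto
    also have "\<dots> = ereal ((1 + \<beta> * \<kappa> * \<alpha>) * b_up x)" by (simp add: algebra_simps)
    finally show ?thesis by (simp flip: \<kappa>(2))
  qed

  text \<open>Since \<open>\<rho>\<close> is only subadditive, the lower bound comes from splitting the cost
    \<open>c \<le> (c + \<beta> * v) + \<beta> * \<kappa> * (- b_lo)\<close>.\<close>
  have \<rho>_lower: "ereal (\<kappa> * b_lo x) \<le> \<rho> (h v (x, a))" if v: "v \<in> I" and q: "(x, a) \<in> D" for v x a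
  proof -
    let ?R = "\<lambda>\<omega>. (\<beta> * \<kappa>) * - b_lo (T x a (Z \<omega>))"
    have R: "?R \<in> Lp_fun M p" using lo_Lp[OF q] by (rule Lp_fun_cmult)
    have "ereal (b_lo x) \<le> \<rho> (\<lambda>\<omega>. c x a (T x a (Z \<omega>)))" using lower1 q by auto
    also have "\<dots> \<le> \<rho> (\<lambda>\<omega>. h v (x, a) \<omega> + ?R \<omega>)"
    proof (rule monetary_mono[OF mon cT_Lp[OF q] Lp_fun_add[OF p0 h_Lp[OF v q] R]])
      fix \<omega> assume "\<omega> \<in> space M"
      then have "\<kappa> * b_lo (T x a (Z \<omega>)) \<le> v (T x a (Z \<omega>))" using v TE[OF q ZN] I_iff by blast
      then show "c x a (T x a (Z \<omega>)) \<le> h v (x, a) \<omega> + ?R \<omega>"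
        using discount by (simp add: h_def mult.assoc)
    qed
    also have "\<dots> \<le> \<rho> (h v (x, a)) + \<rho> ?R"
      using coherent_subadd[OF coh h_Lp[OF v q] R] .
    also have "\<rho> ?R = ereal (\<beta> * \<kappa>) * \<rho> (\<lambda>\<omega>. - b_lo (T x a (Z \<omega>)))"
      using coherent_cmult[OF coh lo_Lp[OF q] \<beta>\<kappa>] .
    also have "\<rho> (h v (x, a)) + \<dots> \<le> \<rho> (h v (x, a)) + ereal (\<beta> * \<kappa>) * ereal (- \<alpha> * b_lo x)"
      using lower2 q \<beta>\<kappa> by (intro add_mono ereal_mult_left_mono) auto
    finally have "ereal (b_lo x) \<le> \<rho> (h v (x, a)) + ereal (\<beta> * \<kappa>) * ereal (- \<alpha> * b_lo x)" .
    moreover have "\<kappa> * b_lo x = b_lo x + \<beta> * \<kappa> * (\<alpha> * b_lo x)"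
      by (subst \<kappa>(2)) (simp add: algebra_simps)
    \<comment> \<open>The value \<open>\<infinity>\<close> makes the claim trivial,
      \<open>-\<infinity>\<close> contradicts the inequality just obtained, and in the real case the
      finite last term is subtracted.\<close>
    ultimately show ?thesis by (cases "\<rho> (h v (x, a))") auto
  qed

  have B_bounds: "ereal (\<kappa> * b_lo x) \<le> B v x" "B v x \<le> ereal (\<kappa> * b_up x)"
    if v: "v \<in> I" and x: "x \<in> E" for v x
  proof -
    show "ereal (\<kappa> * b_lo x) \<le> B v x"
      unfolding B_eq using \<rho>_lower[OF v] by (intro INF_greatest) auto
    \<comment> \<open>A nonempty section of \<open>D\<close> excludes the infimum
      \<open>\<infinity>\<close> of the empty set.\<close>
    obtain a where a: "a \<in> D `` {x}" using D_ne[OF x] by blast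
    show "B v x \<le> ereal (\<kappa> * b_up x)"
      unfolding B_eq using \<rho>_upper[OF v] a by (intro INF_lower2[OF a]) auto
  qed
  \<comment> \<open>\<open>real_of_ereal\<close> sends both infinities to \<open>0\<close>;
    finiteness makes it faithful here.\<close>
  have B_fin: "\<bar>B v x\<bar> \<noteq> \<infinity>" if "v \<in> I" "x \<in> E" for v x
    using B_bounds[OF that] by auto
  have B_real: "ereal (real_of_ereal (B v x)) = B v x" if "v \<in> I" "x \<in> E" for v x
    using B_fin[OF that] by (simp add: ereal_real')

  \<comment> \<open>Lower semicontinuity of the Bellman image\<close>
  have h_lsc: "lsc_on D (\<lambda>q. h v q \<omega>)" if v: "v \<in> I" and \<omega>: "\<omega> \<in> space M" for v \<omega>
  proof -
    let ?T = "\<lambda>q. T (fst q) (snd q) (Z \<omega>)"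
    have T: "continuous_on D ?T" using T_cont ZN[OF \<omega>] by (auto simp: case_prod_unfold)
    have T_in: "?T q \<in> E" if "q \<in> D" for q using TE[of "fst q" "snd q"] ZN[OF \<omega>] that by simp
    \<comment> \<open>With the disturbance fixed, \<open>q \<mapsto> (q, ?T q)\<close> is continuous
      from \<open>D\<close> into \<open>D \<times> E\<close>, so composing \<open>c\<close> with it
      preserves semicontinuity. The same works for \<open>v\<close> after \<open>?T\<close>, and
      \<open>\<beta> > 0\<close> allows the scaling.\<close>
    have "lsc_on D (\<lambda>q. (\<lambda>((x, a), y). c x a y) (q, ?T q))"
      using T T_in by (intro lsc_on_compose[OF c_lsc] continuous_intros) auto
    moreover have "lsc_on D (\<lambda>q. v (?T q))"
      by (rule lsc_on_compose[OF _ T]) (use v T_in in \<open>auto simp: I_iff\<close>)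
    ultimately show ?thesis
      unfolding h_def using discount by (intro lsc_on_add lsc_on_cmult) (auto simp: case_prod_unfold)
  qed
  have \<rho>_lsc: "\<rho> (h v q) \<le> liminf (\<lambda>n. \<rho> (h v (qs n)))"
    if v: "v \<in> I" and q: "q \<in> D" "\<And>n. qs n \<in> D" "qs \<longlonglongrightarrow> q" for v q qs
  proof -
    obtain \<epsilon> \<Theta>1 \<Theta>2 where \<epsilon>: "\<epsilon> > 0"
      and \<Theta>: "(\<lambda>\<omega>. \<Theta>1 (Z \<omega>)) \<in> Lp_fun M p" "(\<lambda>\<omega>. \<Theta>2 (Z \<omega>)) \<in> Lp_fun M p"
      and le: "\<forall>z\<in>space N. \<forall>(x, a) \<in> D \<inter> cball q \<epsilon>.
           \<bar>c x a (T x a z)\<bar> \<le> \<Theta>1 z \<and> b (T x a z) \<le> \<Theta>2 z"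
      using local_bound q(1) by (fast dest: bspec)
    show ?thesis
    proof (rule Fatou_property_lsc[OF p0 mon Fatou _ h_lsc[OF v] _ \<epsilon> _ q])
      \<comment> \<open>One dominating variable serves the whole ball: the cost is at most
        \<open>\<Theta>1\<close> in modulus, and \<open>v\<close> at most
        \<open>\<kappa> * b\<close>, hence at most \<open>\<kappa> * \<Theta>2\<close>.\<close>
      show "(\<lambda>\<omega>. \<Theta>1 (Z \<omega>) + (\<beta> * \<kappa>) * \<Theta>2 (Z \<omega>)) \<in> Lp_fun M p"
        by (intro Lp_fun_add[OF p0] Lp_fun_cmult \<Theta>)
      show "h v r \<in> borel_measurable M" if "r \<in> D" for r
        using h_Lp[OF v that] by (simp add: Lp_fun_def)
      fix \<omega> r assume \<omega>: "\<omega> \<in> space M" and r: "r \<in> D \<inter> cball q \<epsilon>"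
      obtain x a where xa: "r = (x, a)" by (cases r)
      let ?y = "T x a (Z \<omega>)"
      have 1: "\<bar>c x a ?y\<bar> \<le> \<Theta>1 (Z \<omega>)" and 2: "b ?y \<le> \<Theta>2 (Z \<omega>)"
        using le r ZN[OF \<omega>] unfolding xa by blast+
      have "\<bar>\<beta> * v ?y\<bar> \<le> \<beta> * (\<kappa> * b ?y)"
        using discount v_abs[OF v TE[OF _ ZN[OF \<omega>]], of x a] r xa by (simp add: abs_mult)
      also have "\<dots> \<le> (\<beta> * \<kappa>) * \<Theta>2 (Z \<omega>)"
        using mult_left_mono[OF 2 \<beta>\<kappa>] by (simp add: mult.assoc)
      finally show "\<bar>h v r \<omega>\<bar> \<le> \<Theta>1 (Z \<omega>) + (\<beta> * \<kappa>) * \<Theta>2 (Z \<omega>)"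
        using 1 by (simp add: h_def xa)
    qed
  qed
  have B_in: "(\<lambda>x. real_of_ereal (B v x)) \<in> I" if v: "v \<in> I" for v
    unfolding I_iff
  proof (intro conjI ballI)
    show "lsc_on E (\<lambda>x. real_of_ereal (B v x))"
      unfolding B_eq using B_fin[OF v]
      by (intro lsc_on_INF_usc_corr[OF D_usc] \<rho>_lsc[OF v]) (auto simp: B_eq)
    fix x assume "x \<in> E"
    from B_bounds[OF v this] B_real[OF v this]
    show "\<kappa> * b_lo x \<le> real_of_ereal (B v x)" "real_of_ereal (B v x) \<le> \<kappa> * b_up x"
      by (metis ereal_less_eq(3))+
  qed

  \<comment> \<open>The contraction estimate\<close>
  have B_le: "real_of_ereal (B v1 x) \<le> real_of_ereal (B v2 x) + \<alpha> * \<beta> * K * b x"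
    if v1: "v1 \<in> I" and v2: "v2 \<in> I" and K: "0 \<le> K" "\<And>y. y \<in> E \<Longrightarrow> v1 y \<le> v2 y + K * b y"
      and x: "x \<in> E" for v1 v2 K x
  proof -
    \<comment> \<open>The constant does not depend on \<open>a\<close> and stands on the left, so a
      bound valid for every \<open>a\<close> passes to the infimum defining
      \<open>B v2 x\<close>.\<close>
    have "B v1 x - ereal (\<alpha> * \<beta> * K * b x) \<le> \<rho> (h v2 (x, a))" if "a \<in> D `` {x}" for a
    proof -
      have q: "(x, a) \<in> D" using that by simp
      let ?R = "\<lambda>\<omega>. (\<beta> * K) * b (T x a (Z \<omega>))"
      have R: "?R \<in> Lp_fun M p" using bT_Lp[OF q] by (rule Lp_fun_cmult)
      have \<beta>K: "0 \<le> \<beta> * K" using K discount by simp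
      have "B v1 x \<le> \<rho> (h v1 (x, a))" unfolding B_eq using that by (rule INF_lower)
      also have "\<dots> \<le> \<rho> (\<lambda>\<omega>. h v2 (x, a) \<omega> + ?R \<omega>)"
      proof (rule monetary_mono[OF mon h_Lp[OF v1 q] Lp_fun_add[OF p0 h_Lp[OF v2 q] R]])
        fix \<omega> assume "\<omega> \<in> space M"
        then have "\<beta> * v1 (T x a (Z \<omega>)) \<le> \<beta> * (v2 (T x a (Z \<omega>)) + K * b (T x a (Z \<omega>)))"
          using K(2)[OF TE[OF q ZN]] discount by simp
        then show "h v1 (x, a) \<omega> \<le> h v2 (x, a) \<omega> + ?R \<omega>" by (simp add: h_def algebra_simps)
      qed
      also have "\<dots> \<le> \<rho> (h v2 (x, a)) + \<rho> ?R"
        using coherent_subadd[OF coh h_Lp[OF v2 q] R] .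
      also have "\<rho> ?R = ereal (\<beta> * K) * \<rho> (\<lambda>\<omega>. b (T x a (Z \<omega>)))"
        using coherent_cmult[OF coh bT_Lp[OF q] \<beta>K] .
      also have "\<rho> (h v2 (x, a)) + \<dots> \<le> \<rho> (h v2 (x, a)) + ereal (\<beta> * K) * ereal (\<alpha> * b x)"
        using \<rho>_b[OF q] \<beta>K by (intro add_mono ereal_mult_left_mono) auto
      also have "ereal (\<beta> * K) * ereal (\<alpha> * b x) = ereal (\<alpha> * \<beta> * K * b x)" by (simp add: mult_ac)
      finally show ?thesis by (simp add: ereal_minus_le)
    qed
    then have "B v1 x - ereal (\<alpha> * \<beta> * K * b x) \<le> B v2 x"
      unfolding B_eq[of v2] by (rule INF_greatest)
    then have "ereal (real_of_ereal (B v1 x)) - ereal (\<alpha> * \<beta> * K * b x) \<le> ereal (real_of_ereal (B v2 x))"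
      using B_real[OF v1 x] B_real[OF v2 x] by simp
    then show ?thesis by simp
  qed
  have contraction: "weighted_norm E b (\<lambda>x. real_of_ereal (B v1 x) - real_of_ereal (B v2 x))
         \<le> ereal (\<alpha> * \<beta>) * weighted_norm E b (\<lambda>x. v1 x - v2 x)"
    if v1: "v1 \<in> I" and v2: "v2 \<in> I" for v1 v2
  proof -
    let ?n = "weighted_norm E b (\<lambda>x. v1 x - v2 x)"
    have n_upper: "ereal (\<bar>v1 y - v2 y\<bar> / b y) \<le> ?n" if "y \<in> E" for y
      unfolding weighted_norm_def using that by (rule SUP_upper)
    \<comment> \<open>The norm is extended real, while \<open>B_le\<close> needs a real
      \<open>K\<close>. The bounds on \<open>I\<close> exclude \<open>\<infinity>\<close>;
      nonemptiness of \<open>E\<close> excludes \<open>-\<infinity>\<close>, the supremum of the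
      empty set.\<close>
    have "?n \<le> ereal (2 * \<kappa>)"
      unfolding weighted_norm_def
    proof (rule SUP_least)
      fix y assume y: "y \<in> E"
      have "\<bar>v1 y - v2 y\<bar> \<le> 2 * \<kappa> * b y" using v_abs[OF v1 y] v_abs[OF v2 y] by linarith
      then show "ereal (\<bar>v1 y - v2 y\<bar> / b y) \<le> ereal (2 * \<kappa>)"
        using b_ge1[OF y] by (simp add: divide_le_eq)
    qed
    moreover have "0 \<le> ?n"
    proof -
      obtain y where y: "y \<in> E" using E_Borel by blast
      have "0 \<le> ereal (\<bar>v1 y - v2 y\<bar> / b y)" using b_ge1[OF y] by simp
      then show ?thesis using n_upper[OF y] by (rule order_trans)
    qed
    ultimately obtain K where K: "?n = ereal K" "0 \<le> K" by (cases ?n) auto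
    have diff: "\<bar>v1 y - v2 y\<bar> \<le> K * b y" if "y \<in> E" for y
      using n_upper[OF that] b_ge1[OF that] K(1) by (simp add: divide_le_eq)
    have le: "v1 y \<le> v2 y + K * b y" "v2 y \<le> v1 y + K * b y" if "y \<in> E" for y
      using diff[OF that] by linarith+
    have "weighted_norm E b (\<lambda>x. real_of_ereal (B v1 x) - real_of_ereal (B v2 x)) \<le> ereal (\<alpha> * \<beta> * K)"
      unfolding weighted_norm_def
    proof (rule SUP_least)
      fix x assume x: "x \<in> E"
      have "\<bar>real_of_ereal (B v1 x) - real_of_ereal (B v2 x)\<bar> \<le> \<alpha> * \<beta> * K * b x"
        using B_le[OF v1 v2 K(2) le(1) x] B_le[OF v2 v1 K(2) le(2) x] by linarith
      then show "ereal (\<bar>real_of_ereal (B v1 x) - real_of_ereal (B v2 x)\<bar> / b x) \<le> ereal (\<alpha> * \<beta> * K)"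
        using b_ge1[OF x] by (simp add: divide_le_eq)
    qed
    then show ?thesis by (simp add: K(1))
  qed
  show ?thesis using \<alpha>_pos discount contr B_fin B_in contraction by auto
qed

end
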